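(* Let $p\ge 5$ be prime and put $n=d=p-1$. Define $\phi\in\mathbb R^{\mathbb F_p^\times}$ by $\phi(1)=0$ and $\phi(m)=\frac{1}{\sqrt{n-1}}$ for $m\ne 1$. Then the affine orbit measurement operator $\mathcal M_\phi$ satisfies $$\|\mathcal M_\phi(A)\|_{\ell^2(G)}\ \ge\ \frac{2\sqrt p}{n-1}\,\sin\!\Big(\frac{\pi}{2n}\Big)\,\|A\|_F\qquad\text{for every }A\in\mathbb C^{\mathbb F_p^\times\times\mathbb F_p^\times}.$$ Consequently $\mathcal M_\phi$ is injective and admits a linear inverse on its range with operator norm $O(d^{3/2})$ (with an absolute implied constant). Moreover, this order is sharp for this generator: there is a nonzero matrix $A$ such that $$\|\mathcal M_\phi(A)\|_{\ell^2(G)}\ \le\ \frac{\sqrt3\,\pi\sqrt p}{(n-1)n}\,\|A\|_F .$$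
   Context: $G=\mathbb F_p\rtimes\mathbb F_p^\times$ is the affine group with product $(k,l)(k',l')=(k+lk',ll')$. It acts on $\mathbb C^{\mathbb F_p^\times}$ (functions on $\mathbb F_p^\times$ with the standard inner product) by the unitary representation $(\pi(k,l)f)(m)=e_p(km)f(lm)$, where $e_p(x)=\exp(2\pi i x/p)$. For a vector $\phi$, the orbit measurement operator is the linear map $\mathcal M_\phi:\mathbb C^{\mathbb F_p^\times\times\mathbb F_p^\times}\to\mathbb C^G$, $\mathcal M_\phi(A)(g)=\langle A\pi(g)\phi,\pi(g)\phi\rangle$. $\|\cdot\|_F$ is the Frobenius norm and $\|\cdot\|_{\ell^2(G)}$ is the $\ell^2$ norm with counting measure on $G$. *)

theory Defs
  imports "HOL-Analysis.Analysis" "HOL-Number_Theory.Residues"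
begin

text \<open>
  The field $\mathbb{F}_p$ is \<^term>\<open>residue_ring (int p)\<close>, with carrier \<open>{0..p - 1}\<close>, and
  $\mathbb{F}_p^\times$ is its set of units. The modulus is a term and not a type, so that a
  constant can be quantified before \<open>p\<close>.
\<close>

abbreviation Fp :: "nat \<Rightarrow> int ring" where
  "Fp p \<equiv> residue_ring (int p)"

abbreviation Fpx :: "nat \<Rightarrow> int set" where
  "Fpx p \<equiv> Units (Fp p)"

definition affine_group :: "nat \<Rightarrow> (int \<times> int) monoid" where
  "affine_group p =
     \<lparr> carrier = carrier (Fp p) \<times> Fpx p,
       monoid.mult = (\<lambda>(k, l) (k', l').
         (k \<oplus>\<^bsub>Fp p\<^esub> l \<otimes>\<^bsub>Fp p\<^esub> k', l \<otimes>\<^bsub>Fp p\<^esub> l')),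
       one = (\<zero>\<^bsub>Fp p\<^esub>, \<one>\<^bsub>Fp p\<^esub>) \<rparr>"

text \<open>
  The space $\mathbb{C}^I$ is the set of functions on the ambient type that vanish off \<open>I\<close>, so that
  its vectors are equal iff they agree on \<open>I\<close>, and its operations are the pointwise ones.
  Matrices are elements of \<open>cspace (I \<times> I)\<close>.
\<close>

definition cspace :: "'i set \<Rightarrow> ('i \<Rightarrow> complex) set" where
  "cspace I = {f. \<forall>i. i \<notin> I \<longrightarrow> f i = 0}"

text \<open>On \<open>I \<times> I\<close> this is the Frobenius norm.\<close>

definition l2norm :: "'i set \<Rightarrow> ('i \<Rightarrow> complex) \<Rightarrow> real" where
  "l2norm I f = L2_set (\<lambda>i. cmod (f i)) I"

text \<open>The inner product is linear in its first argument; this makes \<open>orbit_meas\<close> below linear.\<close>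

definition cinner_on :: "'i set \<Rightarrow> ('i \<Rightarrow> complex) \<Rightarrow> ('i \<Rightarrow> complex) \<Rightarrow> complex" where
  "cinner_on I f g = (\<Sum>i\<in>I. f i * cnj (g i))"

definition matvec :: "'i set \<Rightarrow> ('i \<times> 'i \<Rightarrow> complex) \<Rightarrow> ('i \<Rightarrow> complex) \<Rightarrow> 'i \<Rightarrow> complex" where
  "matvec I A f = (\<lambda>m. \<Sum>m'\<in>I. A (m, m') * f m')"

definition clinear_on ::
    "('i \<Rightarrow> complex) set \<Rightarrow> (('i \<Rightarrow> complex) \<Rightarrow> ('j \<Rightarrow> complex)) \<Rightarrow> bool" where
  "clinear_on S L \<longleftrightarrow>
     (\<forall>x\<in>S. \<forall>y\<in>S. L (\<lambda>i. x i + y i) = (\<lambda>j. L x j + L y j)) \<and>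
     (\<forall>c. \<forall>x\<in>S. L (\<lambda>i. c * x i) = (\<lambda>j. c * L x j))"

text \<open>
  The analogue of \<^const>\<open>onorm\<close> for a map from a subspace \<open>S\<close> of $\mathbb{C}^I$ to $\mathbb{C}^J$
  with the $\ell^2$ norms. For finite \<open>I\<close> and \<open>J\<close> and linear \<open>L\<close> the quotients are bounded, so the
  supremum is a genuine one.
\<close>

definition opnorm_on ::
    "'i set \<Rightarrow> 'j set \<Rightarrow> ('i \<Rightarrow> complex) set \<Rightarrow> (('i \<Rightarrow> complex) \<Rightarrow> ('j \<Rightarrow> complex)) \<Rightarrow> real" where
  "opnorm_on I J S L = (SUP x\<in>S. l2norm J (L x) / l2norm I x)"

definition e_char :: "nat \<Rightarrow> int \<Rightarrow> complex" where
  "e_char p x = exp (2 * of_real pi * \<i> * of_int x / of_nat p)"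

definition aff_rep :: "nat \<Rightarrow> int \<times> int \<Rightarrow> (int \<Rightarrow> complex) \<Rightarrow> int \<Rightarrow> complex" where
  "aff_rep p = (\<lambda>(k, l) f m.
     if m \<in> Fpx p then e_char p (k \<otimes>\<^bsub>Fp p\<^esub> m) * f (l \<otimes>\<^bsub>Fp p\<^esub> m) else 0)"

definition orbit_meas ::
    "nat \<Rightarrow> (int \<Rightarrow> complex) \<Rightarrow> (int \<times> int \<Rightarrow> complex) \<Rightarrow> int \<times> int \<Rightarrow> complex" where
  "orbit_meas p \<phi> A = (\<lambda>g.
     if g \<in> carrier (affine_group p)
     then cinner_on (Fpx p) (matvec (Fpx p) A (aff_rep p g \<phi>)) (aff_rep p g \<phi>)
     else 0)"

definition punctured_gen :: "nat \<Rightarrow> int \<Rightarrow> complex" where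
  "punctured_gen p m =
     (if m \<in> Fpx p \<and> m \<noteq> \<one>\<^bsub>Fp p\<^esub> then of_real (1 / sqrt (real (p - 1) - 1)) else 0)"

end

theory Submission
  imports Defs
begin

text \<open>
  Summing over the translations \<open>k\<close> and using Parseval splits \<open>\<parallel>M A\<parallel>\<^sup>2\<close> into contributions of the cyclic
  diagonals \<open>t = m' - m\<close> of \<open>A\<close>. On the main diagonal the generator yields \<open>J - I\<close> with \<open>J\<close> the
  all-ones matrix. On a diagonal \<open>t \<noteq> 0\<close> rescale the entries by \<open>m = t j\<close> to a sequence
  \<open>a\<^sub>0 = 0, a\<^sub>1, \<dots>, a\<^sub>n = 0\<close>; up to the factor \<open>1 / (n - 1)\<close> the measurements are
  \<open>S - a\<^sub>v - a\<^sub>v\<^sub>-\<^sub>1\<close> with \<open>S = \<Sum> a\<^sub>j\<close>. Since \<open>\<Sum> (a\<^sub>v + a\<^sub>v\<^sub>-\<^sub>1) = 2 S\<close>, the sum of their squares is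
  \<open>(n - 4) \<bar>S\<bar>\<^sup>2 + \<Sum> \<bar>a\<^sub>v + a\<^sub>v\<^sub>-\<^sub>1\<bar>\<^sup>2\<close>, and the second term is bounded below by a discrete Wirtinger
  inequality with constant \<open>4 sin\<^sup>2 (\<pi> / 2n)\<close>. Its extremal sequence \<open>(-1)\<^sup>j sin (\<pi> j / n)\<close> has
  \<open>S = - tan (\<pi> / 2n)\<close> and, placed on the diagonal \<open>t = 1\<close>, gives the upper bound.
\<close>

section \<open>A discrete Wirtinger inequality\<close>

lemma sum_norm_power2_diff_shift:
  fixes a :: "nat \<Rightarrow> complex"
  assumes "a 0 = 0" "a n = 0"
  shows "(\<Sum>v=1..n. (cmod ((\<Sum>j=1..n. a j) - (a v + a (v - 1))))\<^sup>2)
       = (real n - 4) * (cmod (\<Sum>j=1..n. a j))\<^sup>2 + (\<Sum>v=1..n. (cmod (a v + a (v - 1)))\<^sup>2)"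
proof -
  define S where "S = (\<Sum>j=1..n. a j)"
  \<comment> \<open>The shift loses \<open>a n\<close> and gains \<open>a 0\<close>, both zero, so
    the sum is unchanged.\<close>
  have shift: "(\<Sum>v=1..n. a (v - 1)) = S"
  proof (cases n)
    case (Suc k)
    have "(\<Sum>v=1..n. a (v - 1)) = (\<Sum>v=0..k. a v)"
      using sum.shift_bounds_cl_Suc_ivl[of "\<lambda>v. a (v - 1)" 0 k] Suc by simp
    also have "\<dots> = S"
      using assms Suc by (simp add: S_def sum.atLeast_Suc_atMost)
    finally show ?thesis .
  qed (simp add: S_def)
  have D: "(\<Sum>v=1..n. a v + a (v - 1)) = 2 * S"
    using shift by (simp add: sum.distrib S_def)
  have "(\<Sum>v=1..n. (cmod (S - (a v + a (v - 1))))\<^sup>2)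
      = (\<Sum>v=1..n. (cmod S)\<^sup>2 - 2 * (S \<bullet> (a v + a (v - 1))) + (cmod (a v + a (v - 1)))\<^sup>2)"
    by (intro sum.cong refl) (simp add: power2_norm_eq_inner inner_diff inner_commute algebra_simps)
  also have "\<dots> = real n * (cmod S)\<^sup>2 - 2 * (S \<bullet> (\<Sum>v=1..n. a v + a (v - 1)))
      + (\<Sum>v=1..n. (cmod (a v + a (v - 1)))\<^sup>2)"
    by (simp only: sum.distrib sum_subtractf sum_distrib_left[symmetric] inner_sum_right[symmetric])
      simp
  also have "S \<bullet> (\<Sum>v=1..n. a v + a (v - 1)) = 2 * (cmod S)\<^sup>2"
    unfolding D by (simp add: power2_norm_eq_inner inner_mult_right algebra_simps inner_complex_def)
  finally show ?thesis
    by (simp add: S_def algebra_simps)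
qed

text \<open>Counterpart for the main diagonal: only one entry is removed from the sum, so the cross
  term is 2 |S|^2 instead of 4 |S|^2.\<close>

lemma sum_norm_power2_diff_self:
  fixes a :: "'i \<Rightarrow> complex"
  shows "(\<Sum>v\<in>I. (cmod ((\<Sum>j\<in>I. a j) - a v))\<^sup>2)
       = (real (card I) - 2) * (cmod (\<Sum>j\<in>I. a j))\<^sup>2 + (\<Sum>v\<in>I. (cmod (a v))\<^sup>2)"
proof -
  define S where "S = (\<Sum>j\<in>I. a j)"
  have "(\<Sum>v\<in>I. (cmod (S - a v))\<^sup>2)
      = (\<Sum>v\<in>I. (cmod S)\<^sup>2 - 2 * (S \<bullet> a v) + (cmod (a v))\<^sup>2)"
    by (intro sum.cong refl) (simp add: power2_norm_eq_inner inner_diff inner_commute algebra_simps)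
  also have "\<dots> = real (card I) * (cmod S)\<^sup>2 - 2 * (S \<bullet> S) + (\<Sum>v\<in>I. (cmod (a v))\<^sup>2)"
    by (simp only: sum.distrib sum_subtractf sum_distrib_left[symmetric] inner_sum_right[symmetric]
        S_def) simp
  finally show ?thesis
    by (simp add: S_def algebra_simps power2_norm_eq_inner)
qed

text \<open>Summation by parts: the left side sums over bonds (v - 1, v), the right side collects
  the two bonds meeting at each site v. Vanishing of \<open>g\<close> at the ends removes the
  unpaired terms.\<close>

lemma sum_dirichlet_shift:
  fixes g s :: "nat \<Rightarrow> real"
  assumes "g 0 = 0" "g n = 0"
  shows "(\<Sum>v=1..n. g v * (1 - s (v - 1) / s v) + g (v - 1) * (1 - s v / s (v - 1)))
       = (\<Sum>v=1..<n. g v * (2 - (s (v - 1) + s (v + 1)) / s v))"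
proof (cases n)
  case (Suc k)
  have "(\<Sum>v=1..n. g (v - 1) * (1 - s v / s (v - 1))) = (\<Sum>v=0..k. g v * (1 - s (v + 1) / s v))"
    using sum.shift_bounds_cl_Suc_ivl[of "\<lambda>v. g (v - 1) * (1 - s v / s (v - 1))" 0 k] Suc by simp
  also have "\<dots> = (\<Sum>v=1..k. g v * (1 - s (v + 1) / s v))"
    using assms by (simp add: sum.atLeast_Suc_atMost)
  finally have 1: "(\<Sum>v=1..n. g (v - 1) * (1 - s v / s (v - 1)))
      = (\<Sum>v=1..k. g v * (1 - s (v + 1) / s v))" .
  have 2: "(\<Sum>v=1..n. g v * (1 - s (v - 1) / s v)) = (\<Sum>v=1..k. g v * (1 - s (v - 1) / s v))"
    using assms Suc by simp
  show ?thesis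
    unfolding sum.distrib 1 2 unfolding sum.distrib[symmetric]
  proof (rule sum.cong)
    fix v
    show "g v * (1 - s (v - 1) / s v) + g v * (1 - s (v + 1) / s v)
        = g v * (2 - (s (v - 1) + s (v + 1)) / s v)"
      unfolding distrib_left[symmetric] add_divide_distrib by simp
  qed (auto simp: Suc)
qed simp

text \<open>The sine is an eigenvector of the path adjacency operator; 2 minus its eigenvalue will
  be the Wirtinger constant.\<close>

lemma sin_add_neighbours:
  assumes "v \<ge> 1"
  shows "sin (pi * real (v - 1) / real n) + sin (pi * real (v + 1) / real n)
       = 2 * cos (pi / real n) * sin (pi * real v / real n)"
proof -
  have "pi * real (v - 1) / real n = pi * real v / real n - pi / real n"
    "pi * real (v + 1) / real n = pi * real v / real n + pi / real n"
    using assms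
    by (simp_all add: of_nat_diff add_divide_distrib diff_divide_distrib distrib_left right_diff_distrib)
  then show ?thesis
    by (simp only: sin_add sin_diff) simp
qed

lemma sin_pi_frac_pos:
  assumes "0 < v" "v < n"
  shows "sin (pi * real v / real n) > 0"
  using assms by (intro sin_gt_zero) (auto simp: field_simps)

text \<open>Jacobi's substitution: after weighting by the positive ground state \<open>sin (\<pi> v / n)\<close> the
  inequality is a sum of arithmetic-geometric mean inequalities.\<close>

lemma wirtinger_alternating:
  fixes a :: "nat \<Rightarrow> complex"
  assumes "a 0 = 0" "a n = 0"
  shows "(\<Sum>v=1..n. (cmod (a v + a (v - 1)))\<^sup>2)
       \<ge> (2 * sin (pi / (2 * real n)))\<^sup>2 * (\<Sum>v=1..n. (cmod (a v))\<^sup>2)"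
proof -
  define s where "s v = sin (pi * real v / real n)" for v :: nat
  have pos: "s v > 0" if "0 < v" "v < n" for v
    unfolding s_def using sin_pi_frac_pos[OF that] .
  have le: "(cmod (a v + a (v - 1)))\<^sup>2 \<ge>
      (cmod (a v))\<^sup>2 * (1 - s (v - 1) / s v) + (cmod (a (v - 1)))\<^sup>2 * (1 - s v / s (v - 1))"
    if v: "v \<in> {1..n}" for v
  proof -
    \<comment> \<open>At either end both \<open>a\<close> and \<open>s\<close> vanish at the outer
      site, so the two sides agree. Inside, both divisors are positive.\<close>
    consider "v = 1" | "v = n" | "0 < v - 1" "v < n" using v by fastforce
    then show ?thesis
    proof cases
      case 1 then show ?thesis using assms by (simp add: s_def)
    next
      case 2 then show ?thesis using assms by (cases "n = 0") (simp_all add: s_def)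
    next
      case 3
      define x y where "x = s v" and "y = s (v - 1)"
      have xy: "x > 0" "y > 0" using 3 pos[of v] pos[of "v - 1"] by (auto simp: x_def y_def)
      \<comment> \<open>This square is zero exactly when \<open>a\<close> alternates in sign with
        moduli proportional to \<open>s\<close> across the bond, which is the extremal
        shape.\<close>
      have "0 \<le> (norm (y *\<^sub>R a v + x *\<^sub>R a (v - 1)))\<^sup>2 / (x * y)"
        using xy by simp
      also have "\<dots> = (y / x) * (cmod (a v))\<^sup>2 + (x / y) * (cmod (a (v - 1)))\<^sup>2
          + 2 * (a v \<bullet> a (v - 1))"
        unfolding power2_norm_eq_inner inner_add inner_scaleR_left inner_scaleR_right
        using xy by (simp add: inner_commute field_simps)
      finally show ?thesis
        unfolding x_def[symmetric] y_def[symmetric] power2_norm_eq_inner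
        by (simp add: inner_add inner_commute algebra_simps)
    qed
  qed
  have "(2 * sin (pi / (2 * real n)))\<^sup>2 = 2 - 2 * cos (pi / real n)"
    using cos_double_sin[of "pi / (2 * real n)"] by (simp add: power_mult_distrib)
  then have "(2 * sin (pi / (2 * real n)))\<^sup>2 * (\<Sum>v=1..<n. (cmod (a v))\<^sup>2)
      = (\<Sum>v=1..<n. (cmod (a v))\<^sup>2 * (2 - 2 * cos (pi / real n)))"
    by (simp add: sum_distrib_left mult.commute)
  also have "\<dots> = (\<Sum>v=1..<n. (cmod (a v))\<^sup>2 * (2 - (s (v - 1) + s (v + 1)) / s v))"
  proof (intro sum.cong refl)
    fix v assume v: "v \<in> {1..<n}"
    then have "s (v - 1) + s (v + 1) = 2 * cos (pi / real n) * s v"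
      unfolding s_def by (intro sin_add_neighbours) auto
    then show "(cmod (a v))\<^sup>2 * (2 - 2 * cos (pi / real n))
        = (cmod (a v))\<^sup>2 * (2 - (s (v - 1) + s (v + 1)) / s v)"
      using pos[of v] v by simp
  qed
  also have "\<dots> = (\<Sum>v=1..n. (cmod (a v))\<^sup>2 * (1 - s (v - 1) / s v)
      + (cmod (a (v - 1)))\<^sup>2 * (1 - s v / s (v - 1)))"
    using assms by (intro sum_dirichlet_shift[symmetric]) auto
  also have "\<dots> \<le> (\<Sum>v=1..n. (cmod (a v + a (v - 1)))\<^sup>2)"
    using le by (rule sum_mono)
  also have "(\<Sum>v=1..<n. (cmod (a v))\<^sup>2) = (\<Sum>v=1..n. (cmod (a v))\<^sup>2)"
    using assms by (intro sum.mono_neutral_left) (auto simp: le_less)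
  finally show ?thesis .
qed

section \<open>The extremal sequence and its energy\<close>

text \<open>Multiplication by 2 cos x splits each term into sines of the odd multiples (2v + 1) x
  and (2v - 1) x, and the alternating signs make the sum telescope.\<close>

lemma sum_alternating_sin:
  "2 * cos x * (\<Sum>v=1..N. (-1) ^ v * sin (2 * x * real v))
     = (-1) ^ N * sin ((2 * real N + 1) * x) - sin (x :: real)"
proof (induction N)
  case (Suc N)
  have "2 * cos x * sin (2 * x * real (Suc N))
      = sin ((2 * real (Suc N) + 1) * x) + sin ((2 * real N + 1) * x)"
    using sin_times_cos[of "2 * x * real (Suc N)" x] by (simp add: algebra_simps)
  then show ?case using Suc by (simp add: algebra_simps)
qed simp

text \<open>Telescoping again, after the squares are replaced by cosines of the double
  angle.\<close>

lemma sum_sin_power2: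
  "4 * sin y * (\<Sum>v=1..N. (sin (y * real v))\<^sup>2)
     = (2 * real N + 1) * sin y - sin ((2 * real N + 1) * (y :: real))"
proof (induction N)
  case (Suc N)
  have "4 * sin y * (sin (y * real (Suc N)))\<^sup>2 = 2 * sin y - 2 * (sin y * cos (2 * (y * real (Suc N))))"
    by (simp only: cos_double_sin right_diff_distrib)
  also have "2 * (sin y * cos (2 * (y * real (Suc N))))
      = sin ((2 * real (Suc N) + 1) * y) - sin ((2 * real N + 1) * y)"
    using cos_times_sin[of "2 * (y * real (Suc N))" y] by (simp add: algebra_simps)
  finally show ?case using Suc by (simp add: algebra_simps)
qed simp

lemma sum_sin_power2_full:
  assumes "n \<ge> 2"
  shows "(\<Sum>v=1..n. (sin (pi * real v / real n))\<^sup>2) = real n / 2"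
proof -
  define y where "y = pi / real n"
  have y: "sin y > 0" "real n * y = pi"
    using assms by (auto simp: y_def field_simps intro!: sin_gt_zero)
  have "(2 * real n + 1) * y = y + 2 * pi"
    using y(2) by (simp add: algebra_simps)
  then have "sin ((2 * real n + 1) * y) = sin y"
    by (simp only: sin_periodic)
  then have "4 * sin y * (\<Sum>v=1..n. (sin (y * real v))\<^sup>2) = (2 * real n + 1) * sin y - sin y"
    using sum_sin_power2[of y n] by (simp only:)
  also have "\<dots> = 4 * sin y * (real n / 2)"
    by (simp add: algebra_simps)
  finally have "4 * sin y * (\<Sum>v=1..n. (sin (y * real v))\<^sup>2) = 4 * sin y * (real n / 2)" .
  then show ?thesis
    using y(1) by (simp add: y_def)
qed

text \<open>The equality case of \<open>wirtinger_alternating\<close>: for g = s^2 each bond term is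
  exactly the square of the difference, and the eigenvalue equation evaluates the sum.\<close>

lemma sum_sin_diff_power2:
  fixes n :: nat
  defines "s \<equiv> \<lambda>v. sin (pi * real v / real n)"
  shows "(\<Sum>v=1..n. (s v - s (v - 1))\<^sup>2)
       = (2 * sin (pi / (2 * real n)))\<^sup>2 * (\<Sum>v=1..n. (s v)\<^sup>2)"
proof (cases "n = 0")
  case False
  have ends: "s 0 = 0" "s n = 0" using False by (simp_all add: s_def)
  \<comment> \<open>This holds at x = 0 too, so the zeros of the sine at the ends need no separate
    treatment.\<close>
  have sq: "x\<^sup>2 * (c - y / x) = c * x\<^sup>2 - x * y" for c x y :: real
    by (cases "x = 0") (simp_all add: power2_eq_square field_simps)
  have "(\<Sum>v=1..n. (s v - s (v - 1))\<^sup>2)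
      = (\<Sum>v=1..n. (s v)\<^sup>2 * (1 - s (v - 1) / s v) + (s (v - 1))\<^sup>2 * (1 - s v / s (v - 1)))"
    unfolding sq by (intro sum.cong refl) (simp add: power2_eq_square algebra_simps)
  also have "\<dots> = (\<Sum>v=1..<n. (s v)\<^sup>2 * (2 - (s (v - 1) + s (v + 1)) / s v))"
    using ends by (intro sum_dirichlet_shift) simp_all
  also have "\<dots> = (\<Sum>v=1..<n. (2 - 2 * cos (pi / real n)) * (s v)\<^sup>2)"
  proof (intro sum.cong refl)
    fix v assume "v \<in> {1..<n}"
    then have "s (v - 1) + s (v + 1) = 2 * cos (pi / real n) * s v"
      unfolding s_def by (intro sin_add_neighbours) simp
    then show "(s v)\<^sup>2 * (2 - (s (v - 1) + s (v + 1)) / s v) = (2 - 2 * cos (pi / real n)) * (s v)\<^sup>2"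
      unfolding sq by (simp add: power2_eq_square algebra_simps)
  qed
  also have "\<dots> = (2 - 2 * cos (pi / real n)) * (\<Sum>v=1..<n. (s v)\<^sup>2)"
    by (simp only: sum_distrib_left)
  also have "(\<Sum>v=1..<n. (s v)\<^sup>2) = (\<Sum>v=1..n. (s v)\<^sup>2)"
    using ends by (intro sum.mono_neutral_left) (auto simp: le_less)
  also have "2 - 2 * cos (pi / real n) = (2 * sin (pi / (2 * real n)))\<^sup>2"
    using cos_double_sin[of "pi / (2 * real n)"] by (simp add: power_mult_distrib)
  finally show ?thesis .
qed simp

lemma minus_one_power_power2: "((- 1 :: real) ^ v)\<^sup>2 = 1"
  by (cases "even v") simp_all

lemma cos_ge_half:
  assumes "0 \<le> x" "x \<le> pi / 3"
  shows "cos x \<ge> 1 / 2"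
  using cos_monotone_0_pi_le[of x "pi / 3"] assms by (simp add: cos_60)

text \<open>With x = pi / (2n), |S| = tan x <= 2 sin x, so the first term is at most 8 N (sin x)^2.
  The second equals 4 N (sin x)^2. Their total 12 N (sin x)^2 <= 12 N x^2 is the source of the
  constant 3 pi^2 / n^2.\<close>

lemma alternating_sin_energy_le:
  fixes n :: nat
  assumes n: "n \<ge> 4" "even n"
  defines "a \<equiv> \<lambda>j. (-1) ^ j * sin (pi * real j / real n)"
  shows "(real n - 4) * (\<Sum>j=1..n. a j)\<^sup>2 + (\<Sum>v=1..n. (a v + a (v - 1))\<^sup>2)
       \<le> 3 * pi\<^sup>2 / (real n)\<^sup>2 * (\<Sum>v=1..n. (a v)\<^sup>2)"
proof -
  define x where "x = pi / (2 * real n)"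
  define N where "N = (\<Sum>v=1..n. (a v)\<^sup>2)"
  define S where "S = (\<Sum>j=1..n. a j)"
  have N: "N = real n / 2"
    using sum_sin_power2_full[of n] n by (simp add: N_def a_def power_mult_distrib minus_one_power_power2)
  have x: "0 \<le> x" "x \<le> pi / 3" "real n * x = pi / 2"
    using n by (auto simp: x_def field_simps)
  have c: "cos x \<ge> 1 / 2" by (rule cos_ge_half[OF x(1,2)])
  have "(2 * real n + 1) * x = x + pi"
    using x(3) by (simp add: algebra_simps)
  \<comment> \<open>Since n is even, the sign in front of sin (x + pi) = - sin x is positive and the
    two terms add up.\<close>
  then have "2 * cos x * (\<Sum>v=1..n. (-1) ^ v * sin (2 * x * real v)) = - 2 * sin x"
    using sum_alternating_sin[of x n] n by simp
  moreover have "(\<Sum>v=1..n. (-1) ^ v * sin (2 * x * real v)) = S"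
    using n by (simp add: S_def a_def x_def)
  ultimately have "(cos x * S)\<^sup>2 = (sin x)\<^sup>2" by (simp add: power2_eq_iff)
  moreover have "(1 / 2)\<^sup>2 * S\<^sup>2 \<le> (cos x * S)\<^sup>2"
    unfolding power_mult_distrib using c by (intro mult_right_mono power_mono) simp_all
  ultimately have S: "S\<^sup>2 \<le> 4 * (sin x)\<^sup>2"
    by (simp add: power_divide)
  have "(\<Sum>v=1..n. (a v + a (v - 1))\<^sup>2)
      = (\<Sum>v=1..n. (sin (pi * real v / real n) - sin (pi * real (v - 1) / real n))\<^sup>2)"
  proof (intro sum.cong refl)
    fix v assume "v \<in> {1..n}"
    then obtain w where "v = Suc w" by (cases v) auto
    then have "a v + a (v - 1) = (-1) ^ v * (sin (pi * real v / real n) - sin (pi * real (v - 1) / real n))"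
      by (simp add: a_def algebra_simps)
    then show "(a v + a (v - 1))\<^sup>2 = (sin (pi * real v / real n) - sin (pi * real (v - 1) / real n))\<^sup>2"
      by (simp add: power_mult_distrib minus_one_power_power2)
  qed
  also have "\<dots> = (2 * sin x)\<^sup>2 * N"
    unfolding sum_sin_diff_power2 by (simp add: x_def N_def a_def power_mult_distrib minus_one_power_power2)
  finally have D: "(\<Sum>v=1..n. (a v + a (v - 1))\<^sup>2) = 4 * (sin x)\<^sup>2 * N"
    by (simp add: power_mult_distrib)
  \<comment> \<open>Here n - 4 is estimated by n = 2 N.\<close>
  have "(real n - 4) * S\<^sup>2 \<le> (2 * N) * (4 * (sin x)\<^sup>2)"
    using S n by (intro mult_mono) (auto simp: N)
  then have "(real n - 4) * S\<^sup>2 + 4 * (sin x)\<^sup>2 * N \<le> 12 * N * (sin x)\<^sup>2"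
    by (simp add: algebra_simps)
  also have "\<dots> \<le> 12 * N * x\<^sup>2"
    using abs_sin_x_le_abs_x[of x] N
    by (intro mult_left_mono) (simp_all add: abs_le_square_iff)
  also have "\<dots> = 3 * pi\<^sup>2 / (real n)\<^sup>2 * N"
    by (simp add: x_def power_divide power_mult_distrib)
  finally show ?thesis unfolding D S_def[symmetric] N_def[symmetric] .
qed

text \<open>A linear lower bound for the sine, obtained from x <= tan x and cos x >= 1/2; it turns
  the sharp constant into a power of n.\<close>

lemma half_le_sin:
  assumes "0 \<le> x" "x \<le> pi / 3"
  shows "x / 2 \<le> sin (x :: real)"
proof -
  have c: "1 / 2 \<le> cos x" by (rule cos_ge_half[OF assms])
  have "x < pi / 2" using assms pi_gt_zero by linarith
  then have "x \<le> tan x"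
    using assms(1) abs_tan_ge[of x] tan_pos_pi2_le[of x] by simp
  then have "x * cos x \<le> sin x"
    using c by (simp add: tan_def field_simps)
  moreover have "x * (1 / 2) \<le> x * cos x"
    using assms(1) c by (rule mult_left_mono[rotated])
  ultimately show ?thesis by simp
qed

section \<open>Linear maps bounded below\<close>

lemma l2norm_nonneg: "0 \<le> l2norm I f"
  by (simp add: l2norm_def L2_set_nonneg)

lemma l2norm_zero: "l2norm I (\<lambda>_. 0) = 0"
  by (simp add: l2norm_def L2_set_def)

lemma cspace_eqI_l2norm:
  assumes "finite I" "f \<in> cspace I" "l2norm I f = 0"
  shows "f = (\<lambda>_. 0)"
  using assms by (auto simp: l2norm_def L2_set_eq_0_iff cspace_def fun_eq_iff)

lemma clinear_on_inv_into:
  assumes inj: "inj_on M V"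
    and V: "\<And>x y. x \<in> V \<Longrightarrow> y \<in> V \<Longrightarrow> (\<lambda>i. x i + y i) \<in> V" "\<And>c x. x \<in> V \<Longrightarrow> (\<lambda>i. c * x i) \<in> V"
    and M: "clinear_on V M"
  shows "clinear_on (M ` V) (inv_into V M)"
  unfolding clinear_on_def
proof (intro conjI ballI allI)
  fix X Y c assume "X \<in> M ` V" "Y \<in> M ` V"
  then obtain x y where xy: "x \<in> V" "y \<in> V" "X = M x" "Y = M y" by auto
  have "inv_into V M (M (\<lambda>i. x i + y i)) = (\<lambda>i. x i + y i)"
    using xy V inj by (intro inv_into_f_f) auto
  then show "inv_into V M (\<lambda>i. X i + Y i) = (\<lambda>j. inv_into V M X j + inv_into V M Y j)"
    using M xy inj by (simp add: clinear_on_def inv_into_f_f)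
next
  fix X c assume "X \<in> M ` V"
  then obtain x where x: "x \<in> V" "X = M x" by auto
  have "inv_into V M (M (\<lambda>i. c * x i)) = (\<lambda>i. c * x i)"
    using x V inj by (intro inv_into_f_f) auto
  then show "inv_into V M (\<lambda>i. c * X i) = (\<lambda>j. c * inv_into V M X j)"
    using M x inj by (simp add: clinear_on_def inv_into_f_f)
qed

text \<open>The boundedness conclusion accompanies the estimate because a real supremum dominates
  its members only over a bounded set; \<open>opnorm_on_inverse_ge\<close> relies on it.\<close>

lemma opnorm_on_inverse_le:
  assumes K: "K > 0" and V: "V \<noteq> {}"
    and LM: "\<And>A. A \<in> V \<Longrightarrow> L (M A) = A"
    and ge: "\<And>A. A \<in> V \<Longrightarrow> K * l2norm J A \<le> l2norm G (M A)"
  shows "opnorm_on G J (M ` V) L \<le> 1 / K"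
    and "bdd_above ((\<lambda>x. l2norm J (L x) / l2norm G x) ` (M ` V))"
proof -
  have *: "l2norm J (L x) / l2norm G x \<le> 1 / K" if "x \<in> M ` V" for x
  proof -
    from that obtain A where A: "A \<in> V" "x = M A" by auto
    show ?thesis
    \<comment> \<open>A quotient with zero denominator is 0 and satisfies the bound
      trivially.\<close>
    proof (cases "l2norm G x = 0")
      case False
      then have "l2norm G x > 0" using l2norm_nonneg[of G x] by simp
      then show ?thesis using ge[OF A(1)] LM[OF A(1)] A(2) K by (simp add: field_simps)
    qed (use K in simp)
  qed
  then show "opnorm_on G J (M ` V) L \<le> 1 / K"
    unfolding opnorm_on_def using V by (intro cSUP_least) auto
  show "bdd_above ((\<lambda>x. l2norm J (L x) / l2norm G x) ` (M ` V))"
    using * by (intro bdd_aboveI2)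
qed

text \<open>A vector that \<open>M\<close> shrinks to a factor at most \<open>k\<close> is expanded
  by \<open>L\<close> by at least 1 / k. The lower bound \<open>ge\<close> ensures that its image
  has positive norm.\<close>

lemma opnorm_on_inverse_ge:
  assumes K: "K > 0"
    and LM: "\<And>A. A \<in> V \<Longrightarrow> L (M A) = A"
    and ge: "\<And>A. A \<in> V \<Longrightarrow> K * l2norm J A \<le> l2norm G (M A)"
    and W: "W \<in> V" "l2norm J W > 0" "l2norm G (M W) \<le> k * l2norm J W"
  shows "1 / k \<le> opnorm_on G J (M ` V) L"
proof -
  have "0 < K * l2norm J W" using K W(2) by simp
  also have le: "\<dots> \<le> l2norm G (M W)" by (rule ge[OF W(1)])
  finally have pos: "l2norm G (M W) > 0" .
  then have "0 < k * l2norm J W" using W(3) by linarith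
  then have "k > 0" using W(2) by (simp add: zero_less_mult_iff)
  then have "1 / k \<le> l2norm J (L (M W)) / l2norm G (M W)"
    using W pos by (simp add: LM field_simps)
  also have "\<dots> \<le> opnorm_on G J (M ` V) L"
    unfolding opnorm_on_def
  proof (rule cSUP_upper)
    show "bdd_above ((\<lambda>x. l2norm J (L x) / l2norm G x) ` (M ` V))"
      using W(1) by (intro opnorm_on_inverse_le(2)[where V = V and L = L, OF K _ LM ge]) auto
  qed (use W(1) in simp)
  finally show ?thesis .
qed

lemma cspace_closed:
  "x \<in> cspace I \<Longrightarrow> y \<in> cspace I \<Longrightarrow> (\<lambda>i. x i + y i) \<in> cspace I"
  "x \<in> cspace I \<Longrightarrow> (\<lambda>i. c * x i) \<in> cspace I"
  by (simp_all add: cspace_def)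

lemma clinear_on_orbit_meas: "clinear_on V (orbit_meas p \<phi>)"
proof -
  have "matvec I (\<lambda>i. x i + y i) f = (\<lambda>m. matvec I x f m + matvec I y f m)"
    "matvec I (\<lambda>i. c * x i) f = (\<lambda>m. c * matvec I x f m)" for I :: "int set" and x y f c
    by (simp_all add: matvec_def sum.distrib distrib_right sum_distrib_left mult.assoc)
  moreover have "cinner_on I (\<lambda>m. f m + g m) h = cinner_on I f h + cinner_on I g h"
    "cinner_on I (\<lambda>m. c * f m) h = c * cinner_on I f h" for I :: "int set" and f g h c
    by (simp_all add: cinner_on_def sum.distrib distrib_right sum_distrib_left mult.assoc)
  ultimately show ?thesis
    by (auto simp: clinear_on_def orbit_meas_def intro!: ext)
qed

section \<open>Additive characters and units modulo a prime\<close>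

lemma e_char_add: "e_char p (x + y) = e_char p x * e_char p y"
  by (simp add: e_char_def exp_add[symmetric] algebra_simps add_divide_distrib)

lemma cnj_e_char: "cnj (e_char p x) = e_char p (- x)"
  by (simp add: e_char_def exp_cnj)

lemma e_char_eq_1_iff:
  assumes "p > 0"
  shows "e_char p x = 1 \<longleftrightarrow> int p dvd x"
proof -
  have "e_char p x = 1 \<longleftrightarrow> (\<exists>n::int. 2 * pi * of_int x / of_nat p = of_int (2 * n) * pi)"
    unfolding e_char_def exp_eq_1 by simp
  also have "\<dots> \<longleftrightarrow> (\<exists>n::int. real_of_int x = real_of_int (int p * n))"
    using assms by (intro ex_cong1) (auto simp: field_simps)
  also have "\<dots> \<longleftrightarrow> int p dvd x"
    by (simp only: of_int_eq_iff dvd_def)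
  finally show ?thesis .
qed

lemma e_char_mod:
  assumes "p > 0"
  shows "e_char p (x mod int p) = e_char p x"
proof -
  have "e_char p x = e_char p (int p * (x div int p)) * e_char p (x mod int p)"
    by (simp add: e_char_add[symmetric])
  also have "e_char p (int p * (x div int p)) = 1"
    using assms by (simp add: e_char_eq_1_iff)
  finally show ?thesis by simp
qed

lemma e_char_of_nat_mult: "e_char p (int k * x) = e_char p x ^ k"
  by (simp add: e_char_def exp_of_nat_mult[symmetric] algebra_simps)

lemma sum_int_atLeastLessThan: "(\<Sum>k\<in>{0..<int p}. f k) = (\<Sum>k<p. f (int k))"
proof -
  have "{0..<int p} = int ` {..<p}"
    using image_int_atLeastLessThan[of 0 p] by (simp add: atLeast0LessThan)
  then show ?thesis by (simp add: sum.reindex)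
qed

text \<open>Orthogonality of characters: when p does not divide x this is a full geometric sum over
  powers of a nontrivial p-th root of unity.\<close>

lemma sum_e_char:
  assumes "p > 0"
  shows "(\<Sum>k\<in>{0..<int p}. e_char p (k * x)) = (if int p dvd x then of_nat p else 0)"
proof (cases "int p dvd x")
  case True
  then have "e_char p (k * x) = 1" for k
    using assms by (simp add: e_char_eq_1_iff)
  then show ?thesis using True by simp
next
  case False
  have "e_char p x \<noteq> 1" "e_char p x ^ p = 1"
    using False assms by (simp_all add: e_char_eq_1_iff e_char_of_nat_mult[symmetric])
  then show ?thesis
    using False by (simp add: sum_int_atLeastLessThan e_char_of_nat_mult sum_gp_strict)
qed

lemma parseval_e_char:
  assumes "p > 0"
  shows "(\<Sum>k\<in>{0..<int p}. (cmod (\<Sum>t\<in>{0..<int p}. e_char p (k * t) * h t))\<^sup>2)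
       = real p * (\<Sum>t\<in>{0..<int p}. (cmod (h t))\<^sup>2)"
proof -
  let ?Z = "{0..<int p}"
  have delta: "int p dvd t - t' \<longleftrightarrow> t' = t" if "t \<in> ?Z" "t' \<in> ?Z" for t t'
  proof
    assume "int p dvd t - t'"
    then have "t mod int p = t' mod int p" by (simp add: mod_eq_dvd_iff)
    then show "t' = t" using that by simp
  qed simp
  have split: "e_char p (k * (t - t')) = e_char p (k * t) * cnj (e_char p (k * t'))" for k t t'
    unfolding cnj_e_char e_char_add[symmetric] by (simp add: right_diff_distrib)
  \<comment> \<open>The squared moduli are expanded over the complex numbers as z times its
    conjugate; with the sum over k innermost, orthogonality leaves only t' = t.\<close>
  have "complex_of_real (\<Sum>k\<in>?Z. (cmod (\<Sum>t\<in>?Z. e_char p (k * t) * h t))\<^sup>2)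
      = (\<Sum>k\<in>?Z. \<Sum>t\<in>?Z. \<Sum>t'\<in>?Z. e_char p (k * (t - t')) * (h t * cnj (h t')))"
    unfolding of_real_sum complex_norm_square cnj_sum sum_product
    by (intro sum.cong refl)
      (simp add: split mult_ac)
  also have "\<dots> = (\<Sum>t\<in>?Z. \<Sum>t'\<in>?Z. \<Sum>k\<in>?Z. e_char p (k * (t - t')) * (h t * cnj (h t')))"
    by (rule trans[OF sum.swap], rule sum.cong[OF refl], rule sum.swap)
  also have "\<dots> = (\<Sum>t\<in>?Z. \<Sum>t'\<in>?Z. if t' = t then of_nat p * (h t * cnj (h t')) else 0)"
    unfolding sum_distrib_right[symmetric] sum_e_char[OF assms]
    by (intro sum.cong refl) (simp add: delta)
  also have "\<dots> = complex_of_real (real p * (\<Sum>t\<in>?Z. (cmod (h t))\<^sup>2))"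
    by (simp add: complex_norm_square sum_distrib_left del: of_real_power)
  finally show ?thesis
    by (simp only: of_real_eq_iff)
qed

locale prime_modulus =
  fixes p :: nat
  assumes prime: "prime p"
begin

lemma Fpx_eq: "Fpx p = {1..int p - 1}"
  using residues_prime.res_prime_units_eq[of p] prime prime_gt_0_nat[OF prime]
  by (simp add: residues_prime_def of_nat_diff)

lemma Fp_mult_eq: "x \<otimes>\<^bsub>Fp p\<^esub> y = (x * y) mod int p"
  by (simp add: residue_ring_def)

lemma carrier_affine_group: "carrier (affine_group p) = {0..<int p} \<times> Fpx p"
  by (auto simp: affine_group_def residue_ring_def)

lemma mult_mod_in_Fpx:
  assumes "x \<in> Fpx p" "y \<in> Fpx p"
  shows "(x * y) mod int p \<in> Fpx p"
proof -
  have "\<not> int p dvd x" "\<not> int p dvd y"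
    using assms by (auto simp: Fpx_eq dest: zdvd_imp_le)
  then have "\<not> int p dvd x * y"
    using prime by (simp add: prime_dvd_mult_iff)
  then have "(x * y) mod int p \<noteq> 0" by (simp add: dvd_eq_mod_eq_0)
  moreover have "0 \<le> (x * y) mod int p" "(x * y) mod int p < int p"
    using prime_gt_0_nat[OF prime] by simp_all
  ultimately show ?thesis by (simp add: Fpx_eq)
qed

lemma mult_mod_cancel:
  assumes "c \<in> Fpx p" "x \<in> {0..<int p}" "y \<in> {0..<int p}" "(c * x) mod int p = (c * y) mod int p"
  shows "x = y"
proof -
  have "\<not> int p dvd c" using assms by (auto simp: Fpx_eq dest: zdvd_imp_le)
  moreover have "int p dvd c * (x - y)"
    using assms(4) by (simp add: mod_eq_dvd_iff right_diff_distrib)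
  ultimately have "int p dvd x - y"
    using prime by (simp add: prime_dvd_mult_iff)
  then have "x mod int p = y mod int p" by (simp add: mod_eq_dvd_iff)
  then show ?thesis using assms by simp
qed

lemma finite_Fpx: "finite (Fpx p)"
  by (simp add: Fpx_eq)

lemma bij_betw_mult_mod:
  assumes "c \<in> Fpx p"
  shows "bij_betw (\<lambda>x. (c * x) mod int p) (Fpx p) (Fpx p)"
proof -
  have "inj_on (\<lambda>x. (c * x) mod int p) (Fpx p)"
    by (rule inj_onI) (rule mult_mod_cancel[OF assms], auto simp: Fpx_eq)
  then show ?thesis
    using endo_inj_surj[OF finite_Fpx, of "\<lambda>x. (c * x) mod int p"] mult_mod_in_Fpx[OF assms]
    by (auto simp: bij_betw_def)
qed

lemma ex1_inverse_mod:
  assumes "c \<in> Fpx p"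
  shows "\<exists>!x. x \<in> Fpx p \<and> (c * x) mod int p = 1"
proof -
  have "1 \<in> Fpx p" using prime_ge_2_nat[OF prime] by (simp add: Fpx_eq)
  then have "1 \<in> (\<lambda>x. (c * x) mod int p) ` Fpx p"
    by (simp only: bij_betw_imp_surj_on[OF bij_betw_mult_mod[OF assms]])
  then obtain x where x: "x \<in> Fpx p" "1 = (c * x) mod int p"
    by (rule imageE)
  show ?thesis
  proof (intro ex1I conjI)
    show "x \<in> Fpx p" "(c * x) mod int p = 1" using x by simp_all
    show "y = x" if "y \<in> Fpx p \<and> (c * y) mod int p = 1" for y
    proof (rule mult_mod_cancel[OF assms])
      show "(c * y) mod int p = (c * x) mod int p" using that x by simp
    qed (use that x in \<open>simp_all add: Fpx_eq\<close>)
  qed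
qed

text \<open>For every \<open>l\<close> the product \<open>c l v\<close> is \<open>1\<close> for exactly one \<open>v\<close>; the resulting map
  \<open>l \<mapsto> v\<close> is an involution.\<close>

lemma sum_reindex_inverse:
  fixes f g :: "int \<Rightarrow> real"
  assumes c: "c \<in> Fpx p"
    and fg: "\<And>l v. l \<in> Fpx p \<Longrightarrow> v \<in> Fpx p \<Longrightarrow> (c * l * v) mod int p = 1 \<Longrightarrow> f l = g v"
  shows "(\<Sum>l\<in>Fpx p. f l) = (\<Sum>v\<in>Fpx p. g v)"
proof -
  define iv where "iv l = (THE v. v \<in> Fpx p \<and> ((c * l) mod int p * v) mod int p = 1)" for l
  have iv: "iv l \<in> Fpx p" "(c * l * iv l) mod int p = 1" if "l \<in> Fpx p" for l
    using theI'[OF ex1_inverse_mod[OF mult_mod_in_Fpx[OF c that]]]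
    unfolding iv_def by (simp_all add: mod_mult_left_eq)
  have inv: "iv (iv l) = l" if "l \<in> Fpx p" for l
  proof -
    have eq: "((c * iv l) mod int p * iv (iv l)) mod int p = ((c * iv l) mod int p * l) mod int p"
      unfolding mod_mult_left_eq using iv[OF that] iv[OF iv(1)[OF that]] by (simp add: mult_ac)
    have mem: "iv (iv l) \<in> {0..<int p}" "l \<in> {0..<int p}"
      using iv(1)[OF iv(1)[OF that]] that by (simp_all add: Fpx_eq)
    show ?thesis
      by (rule mult_mod_cancel[OF mult_mod_in_Fpx[OF c iv(1)[OF that]] mem eq])
  qed
  show ?thesis
  proof (rule sum.reindex_bij_witness[of _ iv iv])
    show "g (iv l) = f l" if "l \<in> Fpx p" for l
      by (rule fg[OF that iv[OF that], symmetric])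
  qed (rule inv iv(1), assumption)+
qed

section \<open>Orbit measurements\<close>

text \<open>The units are not invariant under translation, but the whole field is. Since
  \<open>g\<close> vanishes at 0, the missing residue can be added first.\<close>

lemma sum_Fpx_shift:
  fixes g :: "int \<Rightarrow> 'a :: comm_monoid_add"
  assumes "g 0 = 0"
  shows "(\<Sum>m'\<in>Fpx p. g m') = (\<Sum>t\<in>{0..<int p}. g ((m + t) mod int p))"
proof -
  have p: "int p > 0" using prime_gt_0_nat[OF prime] by simp
  have "(\<Sum>m'\<in>Fpx p. g m') = (\<Sum>m'\<in>{0..<int p}. g m')"
  proof (rule sum.mono_neutral_left)
    show "\<forall>i\<in>{0..<int p} - Fpx p. g i = 0"
    proof
      fix i assume "i \<in> {0..<int p} - Fpx p"
      then have "i = 0" by (auto simp: Fpx_eq)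
      then show "g i = 0" using assms by simp
    qed
  qed (auto simp: Fpx_eq)
  also have "\<dots> = (\<Sum>t\<in>{0..<int p}. g ((m + t) mod int p))"
    by (rule sum.reindex_bij_witness[of _ "\<lambda>t. (m + t) mod int p" "\<lambda>x. (x - m) mod int p"])
      (use p in \<open>auto simp: mod_simps\<close>)
  finally show ?thesis .
qed

text \<open>The contribution of the cyclic diagonal t to the measurements with dilation l, that is,
  their Fourier coefficient in the translation variable.\<close>

definition corr :: "(int \<Rightarrow> complex) \<Rightarrow> (int \<times> int \<Rightarrow> complex) \<Rightarrow> int \<Rightarrow> int \<Rightarrow> complex" where
  "corr \<phi> A l t = (\<Sum>m\<in>Fpx p. A (m, (m + t) mod int p) *
     (\<phi> ((l * (m + t)) mod int p) * cnj (\<phi> ((l * m) mod int p))))"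

text \<open>The entry (m, m') carries the phase of k (m' - m), which depends only on the diagonal,
  so grouping by t = m' - m gives a Fourier sum in k.\<close>

lemma orbit_meas_eq_fourier:
  assumes A: "A \<in> cspace (Fpx p \<times> Fpx p)" and k: "k \<in> {0..<int p}" and l: "l \<in> Fpx p"
  shows "orbit_meas p \<phi> A (k, l) = (\<Sum>t\<in>{0..<int p}. e_char p (k * t) * corr \<phi> A l t)"
proof -
  have p: "p > 0" using prime_gt_0_nat[OF prime] .
  have A0: "A (m, 0) = 0" for m
    using A by (auto simp: cspace_def Fpx_eq)
  have "orbit_meas p \<phi> A (k, l) = (\<Sum>m\<in>Fpx p. (\<Sum>m'\<in>Fpx p. A (m, m') *
      (e_char p (k * m') * \<phi> ((l * m') mod int p))) * cnj (e_char p (k * m) * \<phi> ((l * m) mod int p)))"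
    using k l by (simp add: orbit_meas_def carrier_affine_group cinner_on_def matvec_def aff_rep_def
        Fp_mult_eq e_char_mod[OF p])
  also have "\<dots> = (\<Sum>m\<in>Fpx p. (\<Sum>t\<in>{0..<int p}. A (m, (m + t) mod int p) *
      (e_char p (k * ((m + t) mod int p)) * \<phi> ((l * ((m + t) mod int p)) mod int p)))
      * cnj (e_char p (k * m) * \<phi> ((l * m) mod int p)))"
  proof (rule sum.cong[OF refl], rule arg_cong2[of _ _ _ _ "(*)", OF _ refl])
    fix m
    show "(\<Sum>m'\<in>Fpx p. A (m, m') * (e_char p (k * m') * \<phi> ((l * m') mod int p)))
      = (\<Sum>t\<in>{0..<int p}. A (m, (m + t) mod int p) *
      (e_char p (k * ((m + t) mod int p)) * \<phi> ((l * ((m + t) mod int p)) mod int p)))"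
      by (rule sum_Fpx_shift) (simp add: A0)
  qed
  also have "\<dots> = (\<Sum>m\<in>Fpx p. \<Sum>t\<in>{0..<int p}. e_char p (k * t) * (A (m, (m + t) mod int p) *
     (\<phi> ((l * (m + t)) mod int p) * cnj (\<phi> ((l * m) mod int p)))))"
  proof (unfold sum_distrib_right, intro sum.cong refl)
    fix m t
    have "e_char p (k * ((m + t) mod int p)) = e_char p (k * (m + t))"
      using e_char_mod[OF p, of "k * ((m + t) mod int p)"] e_char_mod[OF p, of "k * (m + t)"]
      by (simp add: mod_mult_right_eq)
    then have "e_char p (k * ((m + t) mod int p)) * cnj (e_char p (k * m)) = e_char p (k * t)"
      by (simp add: cnj_e_char e_char_add[symmetric] algebra_simps)
    then show "A (m, (m + t) mod int p) *
        (e_char p (k * ((m + t) mod int p)) * \<phi> ((l * ((m + t) mod int p)) mod int p))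
        * cnj (e_char p (k * m) * \<phi> ((l * m) mod int p))
      = e_char p (k * t) * (A (m, (m + t) mod int p) *
        (\<phi> ((l * (m + t)) mod int p) * cnj (\<phi> ((l * m) mod int p))))"
      by (simp add: mod_mult_right_eq)
  qed
  also have "\<dots> = (\<Sum>t\<in>{0..<int p}. e_char p (k * t) * corr \<phi> A l t)"
    unfolding corr_def sum_distrib_left by (rule sum.swap)
  finally show ?thesis .
qed

text \<open>Parseval in k for each fixed l removes all interaction between different
  diagonals.\<close>

lemma l2norm_orbit_meas:
  assumes "A \<in> cspace (Fpx p \<times> Fpx p)"
  shows "(l2norm (carrier (affine_group p)) (orbit_meas p \<phi> A))\<^sup>2
       = real p * (\<Sum>t\<in>{0..<int p}. \<Sum>l\<in>Fpx p. (cmod (corr \<phi> A l t))\<^sup>2)"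
proof -
  have "(l2norm (carrier (affine_group p)) (orbit_meas p \<phi> A))\<^sup>2
      = (\<Sum>k\<in>{0..<int p}. \<Sum>l\<in>Fpx p. (cmod (orbit_meas p \<phi> A (k, l)))\<^sup>2)"
    unfolding l2norm_def L2_set_def carrier_affine_group sum.cartesian_product
    by (subst real_sqrt_pow2) (auto intro!: sum_nonneg simp: case_prod_beta)
  also have "\<dots> = (\<Sum>l\<in>Fpx p. \<Sum>k\<in>{0..<int p}. (cmod (\<Sum>t\<in>{0..<int p}. e_char p (k * t) * corr \<phi> A l t))\<^sup>2)"
    by (rule trans[OF sum.swap]) (simp add: orbit_meas_eq_fourier[OF assms])
  also have "\<dots> = real p * (\<Sum>l\<in>Fpx p. \<Sum>t\<in>{0..<int p}. (cmod (corr \<phi> A l t))\<^sup>2)"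
    using prime_gt_0_nat[OF prime] by (simp add: parseval_e_char sum_distrib_left)
  finally show ?thesis by (simp only: sum.swap[of _ "{0..<int p}" "Fpx p"])
qed

lemma l2norm_matrix:
  assumes A: "A \<in> cspace (Fpx p \<times> Fpx p)"
  shows "(l2norm (Fpx p \<times> Fpx p) A)\<^sup>2
       = (\<Sum>t\<in>{0..<int p}. \<Sum>m\<in>Fpx p. (cmod (A (m, (m + t) mod int p)))\<^sup>2)"
proof -
  have A0: "A (m, 0) = 0" for m
    using A by (auto simp: cspace_def Fpx_eq)
  have "(l2norm (Fpx p \<times> Fpx p) A)\<^sup>2 = (\<Sum>m\<in>Fpx p. \<Sum>m'\<in>Fpx p. (cmod (A (m, m')))\<^sup>2)"
    unfolding l2norm_def L2_set_def sum.cartesian_product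
    by (subst real_sqrt_pow2) (auto intro!: sum_nonneg simp: case_prod_beta)
  also have "\<dots> = (\<Sum>m\<in>Fpx p. \<Sum>t\<in>{0..<int p}. (cmod (A (m, (m + t) mod int p)))\<^sup>2)"
    by (rule sum.cong[OF refl], rule sum_Fpx_shift) (simp add: A0)
  finally show ?thesis by (simp only: sum.swap[of _ "{0..<int p}" "Fpx p"])
qed

section \<open>Correlations of the punctured generator\<close>

text \<open>Dilation by \<open>c\<close> moves the puncture from 1 to the inverse \<open>v\<close>
  of \<open>c\<close> and leaves the constant value elsewhere.\<close>

lemma punctured_gen_mult:
  assumes c: "c \<in> Fpx p" and v: "v \<in> Fpx p" and cv: "(c * v) mod int p = 1" and x: "x \<in> Fpx p"
  shows "punctured_gen p ((c * x) mod int p)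
       = (if x = v then 0 else of_real (1 / sqrt (real (p - 1) - 1)))"
proof -
  have "(c * x) mod int p = 1 \<longleftrightarrow> x = v"
    using mult_mod_cancel[OF c, of x v] cv v x by (auto simp: Fpx_eq)
  moreover have "\<one>\<^bsub>Fp p\<^esub> = 1" by (simp add: residue_ring_def)
  ultimately show ?thesis
    using mult_mod_in_Fpx[OF c x] by (simp add: punctured_gen_def)
qed

text \<open>The diagonal is traversed in steps of t, so that the column of the entry j is the row of
  the entry j + 1. A puncture at one index thus hits two consecutive entries. The ends j = 0 and j =
  p - 1 fall on row 0 and column 0, outside the matrix.\<close>

definition diag :: "(int \<times> int \<Rightarrow> complex) \<Rightarrow> int \<Rightarrow> int \<Rightarrow> complex" where
  "diag A t j = A ((t * j) mod int p, (t * (j + 1)) mod int p)"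

lemma gen_square: "p \<ge> 5 \<Longrightarrow> of_real (1 / sqrt (real (p - 1) - 1)) * cnj (of_real (1 / sqrt (real (p - 1) - 1)))
   = complex_of_real (1 / (real (p - 1) - 1))"
  by (simp add: of_nat_diff flip: of_real_mult real_sqrt_mult)

lemma diag_ends:
  assumes "A \<in> cspace (Fpx p \<times> Fpx p)"
  shows "diag A t 0 = 0" "diag A t (int p - 1) = 0"
  using assms by (auto simp: diag_def cspace_def Fpx_eq)

lemma sum_diag:
  assumes "t \<in> Fpx p"
  shows "(\<Sum>m\<in>Fpx p. f (A (m, (m + t) mod int p))) = (\<Sum>j\<in>Fpx p. f (diag A t j))"
  using sum.reindex_bij_betw[OF bij_betw_mult_mod[OF assms], of "\<lambda>m. f (A (m, (m + t) mod int p))"]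
  by (simp add: diag_def mod_simps distrib_left)

text \<open>After rescaling, the entry j has weight \<open>\<phi>\<close> at c (j + 1) times the
  conjugate of \<open>\<phi>\<close> at c j, with c = t l. The puncture at v removes the entries j =
  v and j = v - 1; the others keep the common weight 1 / (n - 1).\<close>

lemma corr_punctured_offdiag:
  assumes p5: "p \<ge> 5" and A: "A \<in> cspace (Fpx p \<times> Fpx p)"
    and t: "t \<in> Fpx p" and l: "l \<in> Fpx p" and v: "v \<in> Fpx p" and tlv: "(t * l * v) mod int p = 1"
  shows "corr (punctured_gen p) A l t = of_real (1 / (real (p - 1) - 1)) *
     ((\<Sum>j\<in>Fpx p. diag A t j) - (diag A t v + diag A t (v - 1)))"
proof -
  define \<phi> where "\<phi> = punctured_gen p"
  define s where "s = complex_of_real (1 / sqrt (real (p - 1) - 1))"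
  define c where "c = (t * l) mod int p"
  have c: "c \<in> Fpx p" "(c * v) mod int p = 1"
    using mult_mod_in_Fpx[OF t l] tlv by (simp_all add: c_def mod_mult_left_eq)
  have gen: "\<phi> ((c * x) mod int p) = (if x = v then 0 else s)" if "x \<in> Fpx p" for x
    using punctured_gen_mult[OF c(1) v c(2) that] by (simp add: \<phi>_def s_def)
  have "corr \<phi> A l t = (\<Sum>j\<in>Fpx p. A ((t * j) mod int p, ((t * j) mod int p + t) mod int p) *
     (\<phi> ((l * ((t * j) mod int p + t)) mod int p) * cnj (\<phi> ((l * ((t * j) mod int p)) mod int p))))"
    unfolding corr_def by (rule sum.reindex_bij_betw[OF bij_betw_mult_mod[OF t], symmetric])
  also have "\<dots> = (\<Sum>j\<in>Fpx p. diag A t j *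
     (\<phi> ((c * (j + 1)) mod int p) * cnj (\<phi> ((c * j) mod int p))))"
  proof (rule sum.cong[OF refl])
    fix j
    have "(l * ((t * j) mod int p + t)) mod int p = (c * (j + 1)) mod int p"
    proof -
      have "(l * ((t * j) mod int p + t)) mod int p = (l * (t * j + t)) mod int p"
        by (metis mod_add_left_eq mod_mult_right_eq)
      also have "\<dots> = (c * (j + 1)) mod int p"
        unfolding c_def mod_mult_left_eq by (simp add: algebra_simps)
      finally show ?thesis .
    qed
    moreover have "(l * ((t * j) mod int p)) mod int p = (c * j) mod int p"
      unfolding c_def mod_mult_left_eq mod_mult_right_eq by (simp add: mult_ac)
    moreover have "((t * j) mod int p + t) mod int p = (t * (j + 1)) mod int p"
      unfolding mod_add_left_eq by (simp add: algebra_simps)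
    ultimately show "A ((t * j) mod int p, ((t * j) mod int p + t) mod int p) *
        (\<phi> ((l * ((t * j) mod int p + t)) mod int p) * cnj (\<phi> ((l * ((t * j) mod int p)) mod int p)))
      = diag A t j * (\<phi> ((c * (j + 1)) mod int p) * cnj (\<phi> ((c * j) mod int p)))"
      by (simp only: diag_def)
  qed
  also have "\<dots> = (\<Sum>j\<in>Fpx p. s * cnj s * (diag A t j - ((if j = v then diag A t v else 0)
     + (if j = v - 1 then diag A t (v - 1) else 0))))"
  proof (intro sum.cong refl)
    fix j assume j: "j \<in> Fpx p"
    show "diag A t j * (\<phi> ((c * (j + 1)) mod int p) * cnj (\<phi> ((c * j) mod int p)))
      = s * cnj s * (diag A t j - ((if j = v then diag A t v else 0)
         + (if j = v - 1 then diag A t (v - 1) else 0)))"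
    \<comment> \<open>For this j the index j + 1 is not a unit and \<open>gen\<close> does not
      apply, but the entry itself is zero.\<close>
    proof (cases "j = int p - 1")
      case True
      then have "diag A t j = 0" using diag_ends[OF A] by simp
      then show ?thesis by (auto simp: True)
    next
      case False
      then have "j + 1 \<in> Fpx p" using j by (auto simp: Fpx_eq)
      then show ?thesis using gen[OF j] gen[of "j + 1"] by auto
    qed
  qed
  also have "\<dots> = s * cnj s * ((\<Sum>j\<in>Fpx p. diag A t j)
      - (diag A t v + (if v - 1 \<in> Fpx p then diag A t (v - 1) else 0)))"
    using v by (simp add: sum_distrib_left[symmetric] sum_subtractf sum.distrib finite_Fpx)
  \<comment> \<open>If v = 1, the index v - 1 = 0 is outside the range of summation, and the entry
    there is zero anyway.\<close>
  also have "(if v - 1 \<in> Fpx p then diag A t (v - 1) else 0) = diag A t (v - 1)"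
    using v diag_ends[OF A, of t] by (cases "v = 1") (auto simp: Fpx_eq)
  finally show ?thesis using gen_square[OF p5] by (simp add: \<phi>_def s_def)
qed

text \<open>On the main diagonal both generator factors are punctured at the same place, so a single
  entry drops out.\<close>

lemma corr_punctured_diag:
  assumes p5: "p \<ge> 5" and l: "l \<in> Fpx p" and v: "v \<in> Fpx p" and lv: "(l * v) mod int p = 1"
  shows "corr (punctured_gen p) A l 0 = of_real (1 / (real (p - 1) - 1)) *
     ((\<Sum>m\<in>Fpx p. A (m, m)) - A (v, v))"
proof -
  define s where "s = complex_of_real (1 / sqrt (real (p - 1) - 1))"
  have "corr (punctured_gen p) A l 0 = (\<Sum>m\<in>Fpx p. s * cnj s * (A (m, m) - (if m = v then A (v, v) else 0)))"
    unfolding corr_def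
    using punctured_gen_mult[OF l v] lv
    by (intro sum.cong refl) (auto simp: s_def Fpx_eq)
  also have "\<dots> = s * cnj s * ((\<Sum>m\<in>Fpx p. A (m, m)) - A (v, v))"
    using v by (simp add: sum_distrib_left[symmetric] sum_subtractf finite_Fpx)
  finally show ?thesis using gen_square[OF p5] by (simp add: s_def)
qed

lemma one_in_Fpx: "1 \<in> Fpx p"
  using prime_ge_2_nat[OF prime] by (simp add: Fpx_eq)

lemma sum_Fpx_nat: "(\<Sum>j\<in>Fpx p. f j) = (\<Sum>j=1..p - 1. f (int j))"
proof -
  have "Fpx p = int ` {1..p - 1}"
    using prime_ge_2_nat[OF prime] image_int_atLeastAtMost[of 1 "p - 1"]
    by (simp add: Fpx_eq of_nat_diff)
  then show ?thesis by (simp add: sum.reindex)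
qed

text \<open>As l runs through the units, so does the puncture v, the inverse of t l. The sum over
  dilations is therefore a sum over positions along the diagonal.\<close>

lemma energy_offdiag:
  assumes p5: "p \<ge> 5" and A: "A \<in> cspace (Fpx p \<times> Fpx p)" and t: "t \<in> Fpx p"
  defines "a \<equiv> \<lambda>j. diag A t (int j)"
  shows "(\<Sum>l\<in>Fpx p. (cmod (corr (punctured_gen p) A l t))\<^sup>2) = (1 / (real (p - 1) - 1))\<^sup>2 *
    ((real (p - 1) - 4) * (cmod (\<Sum>j=1..p - 1. a j))\<^sup>2 + (\<Sum>v=1..p - 1. (cmod (a v + a (v - 1)))\<^sup>2))"
proof -
  define r where "r = 1 / (real (p - 1) - 1)"
  have ends: "a 0 = 0" "a (p - 1) = 0"
    using diag_ends[OF A] prime_ge_2_nat[OF prime] by (simp_all add: a_def of_nat_diff)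
  have "(\<Sum>l\<in>Fpx p. (cmod (corr (punctured_gen p) A l t))\<^sup>2)
      = (\<Sum>v\<in>Fpx p. r\<^sup>2 * (cmod ((\<Sum>j\<in>Fpx p. diag A t j) - (diag A t v + diag A t (v - 1))))\<^sup>2)"
    by (rule sum_reindex_inverse[OF t])
      (simp only: corr_punctured_offdiag[OF p5 A t] norm_mult power_mult_distrib r_def norm_of_real power2_abs)
  also have "\<dots> = (\<Sum>v=1..p - 1. r\<^sup>2 * (cmod ((\<Sum>j=1..p - 1. a j) - (a v + a (v - 1))))\<^sup>2)"
    unfolding sum_Fpx_nat by (intro sum.cong refl) (simp add: a_def of_nat_diff)
  also have "\<dots> = r\<^sup>2 * ((real (p - 1) - 4) * (cmod (\<Sum>j=1..p - 1. a j))\<^sup>2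
      + (\<Sum>v=1..p - 1. (cmod (a v + a (v - 1)))\<^sup>2))"
    by (simp only: sum_distrib_left[symmetric] sum_norm_power2_diff_shift[OF ends])
  finally show ?thesis by (simp only: r_def)
qed

lemma energy_diag:
  assumes p5: "p \<ge> 5"
  shows "(\<Sum>l\<in>Fpx p. (cmod (corr (punctured_gen p) A l 0))\<^sup>2) = (1 / (real (p - 1) - 1))\<^sup>2 *
    ((real (p - 1) - 2) * (cmod (\<Sum>m\<in>Fpx p. A (m, m)))\<^sup>2 + (\<Sum>m\<in>Fpx p. (cmod (A (m, m)))\<^sup>2))"
proof -
  define r where "r = 1 / (real (p - 1) - 1)"
  have card: "card (Fpx p) = p - 1" by (simp add: Fpx_eq)
  have "(\<Sum>l\<in>Fpx p. (cmod (corr (punctured_gen p) A l 0))\<^sup>2)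
      = (\<Sum>v\<in>Fpx p. r\<^sup>2 * (cmod ((\<Sum>m\<in>Fpx p. A (m, m)) - A (v, v)))\<^sup>2)"
    by (rule sum_reindex_inverse[OF one_in_Fpx])
      (simp only: mult_1_left corr_punctured_diag[OF p5] norm_mult power_mult_distrib r_def norm_of_real power2_abs)
  then show ?thesis
    unfolding sum_distrib_left[symmetric] sum_norm_power2_diff_self card r_def .
qed

section \<open>Lower bound, near-extremal matrix and injectivity\<close>

lemma energy_ge:
  assumes p5: "p \<ge> 5" and A: "A \<in> cspace (Fpx p \<times> Fpx p)" and t: "t \<in> {0..<int p}"
  shows "(\<Sum>l\<in>Fpx p. (cmod (corr (punctured_gen p) A l t))\<^sup>2) \<ge>
    (2 * sin (pi / (2 * real (p - 1))) / (real (p - 1) - 1))\<^sup>2 *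
      (\<Sum>m\<in>Fpx p. (cmod (A (m, (m + t) mod int p)))\<^sup>2)"
proof -
  define n where "n = p - 1"
  have n: "n \<ge> 4" using p5 by (simp add: n_def)
  define r where "r = 1 / (real n - 1)"
  define q where "q = 2 * sin (pi / (2 * real n))"
  define N where "N = (\<Sum>m\<in>Fpx p. (cmod (A (m, (m + t) mod int p)))\<^sup>2)"
  have "r\<^sup>2 * (q\<^sup>2 * N) \<le> (\<Sum>l\<in>Fpx p. (cmod (corr (punctured_gen p) A l t))\<^sup>2)"
  proof (cases "t = 0")
    case True
    have N: "N = (\<Sum>m\<in>Fpx p. (cmod (A (m, m)))\<^sup>2)"
      unfolding N_def True by (intro sum.cong refl) (auto simp: Fpx_eq)
    \<comment> \<open>The main diagonal satisfies the bound with constant 1 in place of q^2, so q <=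
      1 suffices; it follows from sin y <= y and pi < 4 <= n.\<close>
    have "pi / (2 * real n) \<ge> 0" "pi / (2 * real n) \<le> 1 / 2"
      using n pi_less_4 by (auto simp: field_simps)
    then have "0 \<le> q" "q \<le> 1"
      using sin_x_le_x[of "pi / (2 * real n)"] pi_ge_two
      by (auto simp: q_def intro!: sin_ge_zero)
    then have "q\<^sup>2 * N \<le> 1 * N"
      by (intro mult_right_mono) (auto simp: N_def sum_nonneg power_le_one)
    also have "\<dots> \<le> (real n - 2) * (cmod (\<Sum>m\<in>Fpx p. A (m, m)))\<^sup>2 + N"
      using n by simp
    finally have "r\<^sup>2 * (q\<^sup>2 * N) \<le> r\<^sup>2 * ((real n - 2) * (cmod (\<Sum>m\<in>Fpx p. A (m, m)))\<^sup>2 + N)"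
      by (rule mult_left_mono) simp
    then show ?thesis
      unfolding True energy_diag[OF p5] N r_def n_def .
  next
    case False
    then have t': "t \<in> Fpx p" using t by (auto simp: Fpx_eq)
    define a where "a j = diag A t (int j)" for j
    have ends: "a 0 = 0" "a n = 0"
      using diag_ends[OF A] p5 by (simp_all add: a_def of_nat_diff n_def)
    have N: "N = (\<Sum>v=1..n. (cmod (a v))\<^sup>2)"
      unfolding N_def sum_diag[OF t', of "\<lambda>z. (cmod z)\<^sup>2"] sum_Fpx_nat n_def a_def ..
    have "q\<^sup>2 * N \<le> (\<Sum>v=1..n. (cmod (a v + a (v - 1)))\<^sup>2)"
      unfolding N q_def by (rule wirtinger_alternating[OF ends])
    \<comment> \<open>The condition n >= 4, that is p >= 5, makes the coefficient of |S|^2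
      nonnegative.\<close>
    also have "\<dots> \<le> (real n - 4) * (cmod (\<Sum>j=1..n. a j))\<^sup>2 + (\<Sum>v=1..n. (cmod (a v + a (v - 1)))\<^sup>2)"
      using n by simp
    finally have "r\<^sup>2 * (q\<^sup>2 * N) \<le> r\<^sup>2 * \<dots>"
      by (rule mult_left_mono) simp
    then show ?thesis
      unfolding energy_offdiag[OF p5 A t'] r_def n_def a_def .
  qed
  then show ?thesis
    by (simp add: r_def q_def N_def n_def power_divide)
qed

lemma l2norm_orbit_meas_punctured_ge:
  assumes p5: "p \<ge> 5" and A: "A \<in> cspace (Fpx p \<times> Fpx p)"
  shows "2 * sqrt (real p) / (real (p - 1) - 1) * sin (pi / (2 * real (p - 1))) * l2norm (Fpx p \<times> Fpx p) A
    \<le> l2norm (carrier (affine_group p)) (orbit_meas p (punctured_gen p) A)"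
proof (rule power2_le_imp_le)
  let ?q = "2 * sin (pi / (2 * real (p - 1))) / (real (p - 1) - 1)"
  have "(2 * sqrt (real p) / (real (p - 1) - 1) * sin (pi / (2 * real (p - 1))) * l2norm (Fpx p \<times> Fpx p) A)\<^sup>2
      = real p * (?q\<^sup>2 * (l2norm (Fpx p \<times> Fpx p) A)\<^sup>2)"
    by (simp add: power_mult_distrib power_divide)
  also have "\<dots> \<le> real p * (\<Sum>t\<in>{0..<int p}. \<Sum>l\<in>Fpx p. (cmod (corr (punctured_gen p) A l t))\<^sup>2)"
    unfolding l2norm_matrix[OF A] sum_distrib_left[of "?q\<^sup>2" _ "{0..<int p}"]
    by (rule mult_left_mono, rule sum_mono, rule energy_ge[OF p5 A]) simp_all
  finally show "(2 * sqrt (real p) / (real (p - 1) - 1) * sin (pi / (2 * real (p - 1))) * l2norm (Fpx p \<times> Fpx p) A)\<^sup>2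
    \<le> (l2norm (carrier (affine_group p)) (orbit_meas p (punctured_gen p) A))\<^sup>2"
    unfolding l2norm_orbit_meas[OF A] .
qed (simp add: l2norm_def L2_set_nonneg)

lemma orbit_meas_punctured_upper:
  assumes p5: "p \<ge> 5"
  defines "n \<equiv> p - 1"
  shows "\<exists>W\<in>cspace (Fpx p \<times> Fpx p). l2norm (Fpx p \<times> Fpx p) W > 0 \<and>
    l2norm (carrier (affine_group p)) (orbit_meas p (punctured_gen p) W)
      \<le> sqrt 3 * pi * sqrt (real p) / ((real n - 1) * real n) * l2norm (Fpx p \<times> Fpx p) W"
proof -
  define a where "a j = (-1) ^ j * sin (pi * real j / real n)" for j :: nat
  \<comment> \<open>On the diagonal t = 1 the rescaling is trivial and consecutive entries are
    adjacent on the superdiagonal, with no wrap-around since column 0 is absent.\<close>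
  define W where "W = (\<lambda>(m, m'). if m \<in> Fpx p \<and> m' \<in> Fpx p \<and> m' = m + 1 then complex_of_real (a (nat m)) else 0)"
  define r where "r = 1 / (real n - 1)"
  define N where "N = (\<Sum>v=1..n. (a v)\<^sup>2)"
  let ?Z = "{0..<int p}"
  have n: "n \<ge> 4" "even n"
    using p5 prime_odd_nat[OF prime] by (auto simp: n_def)
  have W: "W \<in> cspace (Fpx p \<times> Fpx p)"
    by (auto simp: W_def cspace_def)
  have diag: "diag W 1 (int j) = complex_of_real (a j)" if "j \<le> n" for j
  proof -
    \<comment> \<open>At both ends the sine vanishes, as does the entry outside the matrix.\<close>
    from that consider "j = 0" | "j = n" | "0 < j" "j < n" by linarith
    then show ?thesis
    proof cases
      case 1 then show ?thesis using diag_ends[OF W] by (simp add: a_def)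
    next
      case 2 
      then have "int j = int p - 1" using p5 by (simp add: n_def of_nat_diff)
      then show ?thesis using diag_ends[OF W] n 2 by (simp add: a_def)
    next
      case 3
      then have "int j + 1 < int p" unfolding n_def by linarith
      with 3 show ?thesis by (simp add: diag_def W_def Fpx_eq)
    qed
  qed
  have off: "W (m, (m + t) mod int p) = 0" if t: "t \<in> ?Z - {1}" for m t
  proof (rule ccontr)
    assume "W (m, (m + t) mod int p) \<noteq> 0"
    then have "(m + t) mod int p = m + 1" "m + 1 \<in> Fpx p" by (auto simp: W_def split: if_splits)
    then have "(m + t) mod int p = (m + 1) mod int p" by (simp add: Fpx_eq)
    then have "int p dvd t - 1" by (simp add: mod_eq_dvd_iff)
    then have "t mod int p = 1 mod int p" by (simp add: mod_eq_dvd_iff)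
    then show False using t p5 by simp
  qed
  have "(l2norm (Fpx p \<times> Fpx p) W)\<^sup>2 = (\<Sum>t\<in>{1}. \<Sum>m\<in>Fpx p. (cmod (W (m, (m + t) mod int p)))\<^sup>2)"
    unfolding l2norm_matrix[OF W]
    by (rule sum.mono_neutral_right) (use p5 off in auto)
  also have "\<dots> = (\<Sum>j=1..n. (cmod (diag W 1 (int j)))\<^sup>2)"
    using sum_diag[OF one_in_Fpx, of "\<lambda>z. (cmod z)\<^sup>2" W] by (simp add: sum_Fpx_nat n_def)
  also have "\<dots> = N"
    unfolding N_def by (intro sum.cong refl) (simp add: diag)
  finally have normW: "(l2norm (Fpx p \<times> Fpx p) W)\<^sup>2 = N" .
  have "(l2norm (carrier (affine_group p)) (orbit_meas p (punctured_gen p) W))\<^sup>2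
      = real p * (\<Sum>t\<in>{1}. \<Sum>l\<in>Fpx p. (cmod (corr (punctured_gen p) W l t))\<^sup>2)"
    unfolding l2norm_orbit_meas[OF W]
    by (intro arg_cong[of _ _ "\<lambda>x. real p * x"] sum.mono_neutral_right)
      (use p5 off in \<open>auto simp: corr_def\<close>)
  also have "\<dots> = real p * (r\<^sup>2 * ((real n - 4) * (cmod (\<Sum>j=1..n. diag W 1 (int j)))\<^sup>2
      + (\<Sum>v=1..n. (cmod (diag W 1 (int v) + diag W 1 (int (v - 1))))\<^sup>2)))"
    by (simp only: sum.insert sum.empty finite.emptyI empty_iff not_False_eq_True add_0_right
        energy_offdiag[OF p5 W one_in_Fpx] r_def n_def)
  also have "(\<Sum>j=1..n. diag W 1 (int j)) = complex_of_real (\<Sum>j=1..n. a j)"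
    unfolding of_real_sum by (intro sum.cong refl) (simp add: diag)
  also have "(\<Sum>v=1..n. (cmod (diag W 1 (int v) + diag W 1 (int (v - 1))))\<^sup>2)
      = (\<Sum>v=1..n. (a v + a (v - 1))\<^sup>2)"
  proof (intro sum.cong refl)
    fix v assume "v \<in> {1..n}"
    then have "v \<le> n" "v - 1 \<le> n" by auto
    then have "diag W 1 (int v) + diag W 1 (int (v - 1)) = complex_of_real (a v + a (v - 1))"
      by (simp only: diag of_real_add)
    then show "(cmod (diag W 1 (int v) + diag W 1 (int (v - 1))))\<^sup>2 = (a v + a (v - 1))\<^sup>2"
      by (simp only: norm_of_real power2_abs)
  qed
  also have "(cmod (complex_of_real (\<Sum>j=1..n. a j)))\<^sup>2 = (\<Sum>j=1..n. a j)\<^sup>2"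
    by (simp only: norm_of_real power2_abs)
  also have "real p * (r\<^sup>2 * ((real n - 4) * (\<Sum>j=1..n. a j)\<^sup>2 + (\<Sum>v=1..n. (a v + a (v - 1))\<^sup>2)))
      \<le> real p * (r\<^sup>2 * (3 * pi\<^sup>2 / (real n)\<^sup>2 * N))"
    unfolding N_def a_def using alternating_sin_energy_le[OF n] by (intro mult_left_mono) simp_all
  also have "\<dots> = (sqrt 3 * pi * sqrt (real p) / ((real n - 1) * real n) * l2norm (Fpx p \<times> Fpx p) W)\<^sup>2"
    by (simp add: power_mult_distrib power_divide normW r_def)
  finally have "l2norm (carrier (affine_group p)) (orbit_meas p (punctured_gen p) W)
      \<le> sqrt 3 * pi * sqrt (real p) / ((real n - 1) * real n) * l2norm (Fpx p \<times> Fpx p) W"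
    by (rule power2_le_imp_le) (use n in \<open>simp add: l2norm_nonneg\<close>)
  moreover have "l2norm (Fpx p \<times> Fpx p) W > 0"
  proof -
    have "N = real n / 2"
      using sum_sin_power2_full[of n] n by (simp add: N_def a_def power_mult_distrib minus_one_power_power2)
    then have "l2norm (Fpx p \<times> Fpx p) W \<noteq> 0" using normW n by auto
    then show ?thesis using l2norm_nonneg[of "Fpx p \<times> Fpx p" W] by simp
  qed
  ultimately show ?thesis using W by blast
qed

lemma inj_on_orbit_meas_punctured:
  assumes p5: "p \<ge> 5"
  shows "inj_on (orbit_meas p (punctured_gen p)) (cspace (Fpx p \<times> Fpx p))"
proof (rule inj_onI)
  fix A B
  let ?M = "orbit_meas p (punctured_gen p)" and ?V = "cspace (Fpx p \<times> Fpx p)"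
  assume AB: "A \<in> ?V" "B \<in> ?V" "?M A = ?M B"
  \<comment> \<open>The difference is written with a sum and a scalar multiple, the two operations
    in \<open>clinear_on\<close>.\<close>
  define D where "D = (\<lambda>i. A i + (- 1) * B i)"
  have D: "D \<in> ?V"
    unfolding D_def using AB by (intro cspace_closed)
  have "?M D = (\<lambda>j. ?M A j + (- 1) * ?M B j)"
  proof -
    have "clinear_on UNIV ?M" by (rule clinear_on_orbit_meas)
    then have add: "?M (\<lambda>i. x i + y i) = (\<lambda>j. ?M x j + ?M y j)"
      and scale: "?M (\<lambda>i. c * x i) = (\<lambda>j. c * ?M x j)" for x y c
      by (simp_all add: clinear_on_def)
    have "?M D = (\<lambda>j. ?M A j + ?M (\<lambda>i. (- 1) * B i) j)"
      unfolding D_def by (rule add)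
    also have "?M (\<lambda>i. (- 1) * B i) = (\<lambda>j. (- 1) * ?M B j)"
      by (rule scale)
    finally show ?thesis .
  qed
  then have "?M D = (\<lambda>_. 0)" using AB by simp
  moreover define K where "K = 2 * sqrt (real p) / (real (p - 1) - 1) * sin (pi / (2 * real (p - 1)))"
  ultimately have "K * l2norm (Fpx p \<times> Fpx p) D \<le> 0"
    using l2norm_orbit_meas_punctured_ge[OF p5 D] by (simp only: l2norm_zero)
  moreover have "K > 0"
    unfolding K_def using p5 by (intro mult_pos_pos divide_pos_pos sin_gt_zero) (auto simp: field_simps)
  ultimately have "l2norm (Fpx p \<times> Fpx p) D = 0"
    using l2norm_nonneg[of "Fpx p \<times> Fpx p" D] by (simp add: mult_le_0_iff)
  then have "D = (\<lambda>_. 0)"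
    using D by (intro cspace_eqI_l2norm) (auto simp: finite_Fpx)
  then show "A = B" by (simp add: D_def fun_eq_iff)
qed

end

section \<open>Comparison of the constants with n^(3/2), and conclusion\<close>

lemma powr_three_halves: "n > 0 \<Longrightarrow> n powr (3 / 2) = n * sqrt n"
  using powr_add[of n 1 "1 / 2"] by (simp add: powr_half_sqrt)

text \<open>The estimates n + 1 >= n, n - 1 <= n and sin (pi / (2n)) >= 1 / (2n) make the lower
  constant at least n^(-3/2), so the implied constant is 1.\<close>

lemma inverse_lower_constant_le:
  fixes n :: real
  assumes "n \<ge> 4"
  shows "1 / (2 * sqrt (n + 1) / (n - 1) * sin (pi / (2 * n))) \<le> n powr (3 / 2)"
proof -
  have "pi / (2 * n) / 2 \<le> sin (pi / (2 * n))"
    using assms by (intro half_le_sin) (auto simp: field_simps)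
  moreover have "1 / (2 * n) \<le> pi / (2 * n) / 2"
    using assms pi_ge_two by (simp add: field_simps)
  ultimately have s: "1 / (2 * n) \<le> sin (pi / (2 * n))" by linarith
  have "1 / (n * sqrt n) = 2 * sqrt n / n * (1 / (2 * n))"
    using assms by (simp add: field_simps)
  also have "\<dots> \<le> 2 * sqrt (n + 1) / (n - 1) * sin (pi / (2 * n))"
    using assms by (intro mult_mono frac_le s) auto
  finally have "1 / (2 * sqrt (n + 1) / (n - 1) * sin (pi / (2 * n))) \<le> 1 / (1 / (n * sqrt n))"
    using assms s by (intro divide_left_mono mult_pos_pos divide_pos_pos)
      (auto intro: less_le_trans[of 0 "1 / (2 * n)"])
  then show ?thesis using assms by (simp add: powr_three_halves)
qed

text \<open>The factor 4 is the product of the losses in sqrt (n + 1) <= 2 sqrt n and n <= 2 (n -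
  1).\<close>

lemma inverse_upper_constant_ge:
  fixes n :: real
  assumes "n \<ge> 4"
  shows "1 / (4 * sqrt 3 * pi) * n powr (3 / 2) \<le> 1 / (sqrt 3 * pi * sqrt (n + 1) / ((n - 1) * n))"
proof -
  have "sqrt (n + 1) \<le> sqrt (4 * n)" using assms by (intro real_sqrt_le_mono) simp
  then have "sqrt (n + 1) \<le> 2 * sqrt n" by (simp add: real_sqrt_mult)
  then have "n * sqrt n * sqrt (n + 1) \<le> n * sqrt n * (2 * sqrt n)"
    using assms by (intro mult_left_mono) auto
  also have "\<dots> = 2 * n * n" using assms by simp
  also have "\<dots> \<le> 4 * (n - 1) * n" using assms by simp
  finally have "n * sqrt n * sqrt (n + 1) \<le> 4 * (n - 1) * n" .
  then show ?thesis using assms by (simp add: powr_three_halves field_simps)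
qed

theorem theorem1p1:
  shows "\<exists>c C :: real. 0 < c \<and> 0 < C \<and>
    (\<forall>p n d :: nat. prime p \<and> 5 \<le> p \<and> n = p - 1 \<and> d = p - 1 \<longrightarrow>
      (let I = Fpx p;
           G = carrier (affine_group p);
           M = orbit_meas p (punctured_gen p);
           Mat = cspace (I \<times> I)
       in
         (\<forall>A\<in>Mat. l2norm G (M A) \<ge>
            2 * sqrt (real p) / (real n - 1) * sin (pi / (2 * real n)) * l2norm (I \<times> I) A)
       \<and> inj_on M Mat
       \<and> (\<exists>L. clinear_on (M ` Mat) L \<and> (\<forall>A\<in>Mat. L (M A) = A) \<and>
            c * real d powr (3 / 2) \<le> opnorm_on G (I \<times> I) (M ` Mat) L \<and>
            opnorm_on G (I \<times> I) (M ` Mat) L \<le> C * real d powr (3 / 2))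
       \<and> (\<exists>A\<in>Mat. A \<noteq> (\<lambda>_. 0) \<and>
            l2norm G (M A) \<le>
              sqrt 3 * pi * sqrt (real p) / ((real n - 1) * real n) * l2norm (I \<times> I) A)))"
proof (rule exI[of _ "1 / (4 * sqrt 3 * pi)"], rule exI[of _ 1], intro conjI allI impI)
  show "0 < 1 / (4 * sqrt 3 * pi)" "(0::real) < 1" by simp_all
next
  fix p n d :: nat
  assume a: "prime p \<and> 5 \<le> p \<and> n = p - 1 \<and> d = p - 1"
  then interpret prime_modulus p by unfold_locales simp
  define J where "J = Fpx p \<times> Fpx p"
  define G where "G = carrier (affine_group p)"
  define M where "M = orbit_meas p (punctured_gen p)"
  define K where "K = 2 * sqrt (real p) / (real n - 1) * sin (pi / (2 * real n))"
  define k where "k = sqrt 3 * pi * sqrt (real p) / ((real n - 1) * real n)"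
  have p5: "p \<ge> 5" and n: "real n \<ge> 4" "real p = real n + 1" and d: "d = n" "n = p - 1"
    using a by auto
  have ge: "K * l2norm J A \<le> l2norm G (M A)" if "A \<in> cspace J" for A
    using l2norm_orbit_meas_punctured_ge[OF p5, of A] that
    unfolding K_def J_def G_def M_def d by simp
  have inj: "inj_on M (cspace J)"
    unfolding M_def J_def by (rule inj_on_orbit_meas_punctured[OF p5])
  have K: "K > 0"
    unfolding K_def using n by (intro mult_pos_pos divide_pos_pos sin_gt_zero) (auto simp: field_simps)
  obtain W where W: "W \<in> cspace J" "l2norm J W > 0" "l2norm G (M W) \<le> k * l2norm J W"
    using orbit_meas_punctured_upper[OF p5] unfolding J_def G_def M_def k_def d by blast
  have W0: "W \<noteq> (\<lambda>_. 0)" using W(2) by (auto simp: l2norm_zero)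
  \<comment> \<open>On the range of \<open>M\<close> this is the only possible left inverse, so the
    two norm bounds concern the inverse itself and not a favourable choice.\<close>
  let ?L = "inv_into (cspace J) M"
  have LM: "?L (M A) = A" if "A \<in> cspace J" for A
    using inj that by (rule inv_into_f_f)
  have lin: "clinear_on (M ` cspace J) ?L"
    by (rule clinear_on_inv_into[OF inj cspace_closed])
      (auto simp: M_def clinear_on_orbit_meas)
  have "1 / (4 * sqrt 3 * pi) * real d powr (3 / 2) \<le> 1 / k"
    unfolding d(1) k_def n(2) by (rule inverse_upper_constant_ge[OF n(1)])
  also have "\<dots> \<le> opnorm_on G J (M ` cspace J) ?L"
    by (rule opnorm_on_inverse_ge[where V = "cspace J" and L = ?L, OF K LM ge W])
  finally have lower: "1 / (4 * sqrt 3 * pi) * real d powr (3 / 2) \<le> opnorm_on G J (M ` cspace J) ?L" .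
  have "opnorm_on G J (M ` cspace J) ?L \<le> 1 / K"
    using W(1) by (intro opnorm_on_inverse_le(1)[where V = "cspace J" and L = ?L, OF K _ LM ge]) auto
  also have "\<dots> \<le> 1 * real d powr (3 / 2)"
    unfolding d(1) K_def n(2) mult_1 by (rule inverse_lower_constant_le[OF n(1)])
  finally have upper: "opnorm_on G J (M ` cspace J) ?L \<le> 1 * real d powr (3 / 2)" .
  show "let I = Fpx p;
           G = carrier (affine_group p);
           M = orbit_meas p (punctured_gen p);
           Mat = cspace (I \<times> I)
       in
         (\<forall>A\<in>Mat. l2norm G (M A) \<ge>
            2 * sqrt (real p) / (real n - 1) * sin (pi / (2 * real n)) * l2norm (I \<times> I) A)
       \<and> inj_on M Mat
       \<and> (\<exists>L. clinear_on (M ` Mat) L \<and> (\<forall>A\<in>Mat. L (M A) = A) \<and>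
            1 / (4 * sqrt 3 * pi) * real d powr (3 / 2) \<le> opnorm_on G (I \<times> I) (M ` Mat) L \<and>
            opnorm_on G (I \<times> I) (M ` Mat) L \<le> 1 * real d powr (3 / 2))
       \<and> (\<exists>A\<in>Mat. A \<noteq> (\<lambda>_. 0) \<and>
            l2norm G (M A) \<le>
              sqrt 3 * pi * sqrt (real p) / ((real n - 1) * real n) * l2norm (I \<times> I) A)"
    unfolding Let_def J_def[symmetric] G_def[symmetric] M_def[symmetric] K_def[symmetric] k_def[symmetric]
    using ge inj lin LM lower upper W W0 by blast
qed

end
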